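(* Let $M$ be a partially ordered monoid with a family of null sequences $N(M)$, and let $(X,d_{X,M})$ be a partially ordered complete $FM$-distance space in which the $N(M)$-convergence is upper regular. Let $\lambda\in\mathcal{L}(N(M))$ and let $f\colon X\to X$ be non-decreasing (i.e. $x\le y$ implies $f(x)\le f(y)$) and such that $$d_{X,M}(f(x),f(y))\leq\lambda(d_{X,M}(x,y))\quad\text{for all } x,y\in X \text{ with } x\leq y.$$ Assume that there exists $x_0\in X$ such that $x_0\leq f(x_0)$. Then $f$ has at least one fixed point, which is the limit of the sequence $x_n=f(x_{n-1})$, $n\in\mathbb{N}$. This fixed point is the unique fixed point of $f$ inside the set of points $x\in X$ that are comparable with $x_0$. If, moreover, $X$ satisfies the upper Riesz property, then the fixed point is unique in the whole space $X$.
   Context: A monoid $M$ is a set with an associative binary operation $+$ (not assumed commutative) and a two-sided neutral element $\theta_M$. A partially ordered monoid is a monoid $M$ with a partial order $\le$ (reflexive, transitive, antisymmetric) such that $M_+:=\{x\in M:\theta_M\le x\}\neq\{\theta_M\}$ and $x_1\le y_1$, $x_2\le y_2$ imply $x_1+x_2\le y_1+y_2$. A family of null sequences $N(M)$ is a family of sequences in $M_+$ such that: (1) the constant sequence $\{\theta_M\}$ is in $N(M)$, and if a constant sequence $\{x,x,\ldots\}$, $x\in M_+$, is in $N(M)$ then $x=\theta_M$; (2) $\{x_n\},\{y_n\}\in N(M)$ implies $\{x_n+y_n\}\in N(M)$; (3) $\{x_n\}\in N(M)$ and $\theta_M\le y_n\le x_n$ for all $n\in\mathbb{N}$ imply $\{y_n\}\in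 N(M)$; (4) substitution, addition or removal of finitely many elements of a sequence of $N(M)$ (elements of $M_+$) preserves membership in $N(M)$; (5) each subsequence of a sequence of $N(M)$ is in $N(M)$. A family $N(M)$ is fixed. "Increasing" sequences of natural numbers are strictly increasing. For $\{x_n\}\subset M_+$, the series $\sum_{n=1}^\infty x_n$ is a Cauchy series if for all increasing sequences of natural numbers $\{n_k\},\{m_k\}$ with $m_k\ge n_k$ for all $k$ one has $\{\sum_{s=n_k}^{m_k}x_s\}_k\in N(M)$. An $M$-valued distance on a set $X$ is a map $d_{X,M}\colon X\times X\to M_+$ with $d_{X,M}(x,y)=d_{X,M}(y,x)$ and $d_{X,M}(x,y)=\theta_M\iff x=y$. Then $(X,d_{X,M})$ is an $M$-distance space. A sequence $\{x_n\}\subset X$ converges to $x\in X$ ($N(M)$-convergence) if $\{d_{X,M}(x_n,x)\}\in N(M)$; it is a Cauchy sequence if $\{d_{X,M}(x_{n_k},x_{m_k})\}_k\in N(M)$ for all increasing sequences of natural numbers $\{n_k\},\{m_k\}$ with $m_k>n_k$ for all $k$. $(X,d_{X,M})$ is an $FM$-distance space ($FM$-space) if it has the strong Fréchet–Wilson property: for every sequence $\{x_n\}\subset X$ and all increasing sequences of natural numbers $\{n_k\},\{m_k\}$ with $m_k>n_k$ for all $k$, $\{\sum_{s=n_k}^{m_k-1}d_{X,M}(x_s,x_{s+1})\}_k\in N(M)$ implies $\{d_{X,M}(x_{n_k},x_{m_k})\}_k\in N(M)$. It is complete if each Cauchy sequence converges to an element of $X$. It is partially ordered if $X$ is equipped with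 a partial order $\le$. In that case the $N(M)$-convergence is upper regular if for each non-decreasing sequence $x_1\le x_2\le\ldots$ in $X$ converging to $x\in X$ one has $x_n\le x$ for all $n\in\mathbb{N}$. A partially ordered set $X$ satisfies the upper Riesz property if each pair $x,y\in X$ has a supremum (least upper bound) $x\vee y\in X$. Points $x,y\in X$ are comparable if $x\le y$ or $y\le x$. $\mathcal{L}(N(M))$ is the class of maps $\lambda\colon M_+\to M_+$ such that: (1) $x\le y$ implies $\lambda(x)\le\lambda(y)$; (2) $\{x_n\}\in N(M)$ implies $\{\lambda(x_n)\}\in N(M)$; (3) for every $\alpha\in M_+$, $\sum_{n=1}^\infty\lambda^n(\alpha)$ is a Cauchy series, where $\lambda^n$ is the $n$-fold iterate of $\lambda$. *)

theory Defs
  imports Main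
begin

text \<open>
  The additive monoids below need not be commutative, so finite sums are written with
  \<^const>\<open>sum_list\<close>, which keeps the order of the summands. Sequences are indexed from 0.
\<close>

class partially_ordered_monoid = monoid_add + order +
  assumes plus_mono: "x1 \<le> y1 \<Longrightarrow> x2 \<le> y2 \<Longrightarrow> x1 + x2 \<le> y1 + y2"
    and nonneg_nontrivial: "{x. 0 \<le> x} \<noteq> {0}"

text \<open>
  If \<open>r\<close> is strictly increasing and misses only finitely many indices, then \<open>x \<circ> r\<close> arises
  from \<open>x\<close> by removing finitely many elements, and \<open>x\<close> arises from \<open>x \<circ> r\<close> by adding
  finitely many elements at arbitrary positions.
\<close>

locale null_sequence_family =
  fixes N :: "(nat \<Rightarrow> 'm::partially_ordered_monoid) set"
  assumes nonneg: "x \<in> N \<Longrightarrow> 0 \<le> x n"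
    and const_zero: "(\<lambda>_. 0) \<in> N"
    and const_unique: "0 \<le> c \<Longrightarrow> (\<lambda>_. c) \<in> N \<Longrightarrow> c = 0"
    and add: "x \<in> N \<Longrightarrow> y \<in> N \<Longrightarrow> (\<lambda>n. x n + y n) \<in> N"
    and dominated: "x \<in> N \<Longrightarrow> (\<And>n. 0 \<le> y n) \<Longrightarrow> (\<And>n. y n \<le> x n) \<Longrightarrow> y \<in> N"
    and finite_substitution:
      "x \<in> N \<Longrightarrow> (\<And>n. 0 \<le> y n) \<Longrightarrow> finite {n. y n \<noteq> x n} \<Longrightarrow> y \<in> N"
    and finite_addition:
      "x \<circ> r \<in> N \<Longrightarrow> (\<And>n. 0 \<le> x n) \<Longrightarrow> strict_mono r \<Longrightarrow> finite (- range r) \<Longrightarrow> x \<in> N"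
    and finite_removal:
      "x \<in> N \<Longrightarrow> strict_mono r \<Longrightarrow> finite (- range r) \<Longrightarrow> x \<circ> r \<in> N"
    and subsequence: "x \<in> N \<Longrightarrow> strict_mono r \<Longrightarrow> x \<circ> r \<in> N"

definition Cauchy_series ::
    "(nat \<Rightarrow> 'm::partially_ordered_monoid) set \<Rightarrow> (nat \<Rightarrow> 'm) \<Rightarrow> bool" where
  "Cauchy_series N x \<longleftrightarrow>
    (\<forall>n m. strict_mono n \<and> strict_mono m \<and> (\<forall>k. n k \<le> m k) \<longrightarrow>
      (\<lambda>k. sum_list (map x [n k..<Suc (m k)])) \<in> N)"

locale distance_space =
  fixes d :: "'a \<Rightarrow> 'a \<Rightarrow> 'm::partially_ordered_monoid"
  assumes dist_nonneg: "0 \<le> d x y"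
    and dist_sym: "d x y = d y x"
    and dist_eq_zero_iff: "d x y = 0 \<longleftrightarrow> x = y"

definition converges ::
    "(nat \<Rightarrow> 'm) set \<Rightarrow> ('a \<Rightarrow> 'a \<Rightarrow> 'm) \<Rightarrow> (nat \<Rightarrow> 'a) \<Rightarrow> 'a \<Rightarrow> bool" where
  "converges N d x l \<longleftrightarrow> (\<lambda>n. d (x n) l) \<in> N"

definition Cauchy_sequence ::
    "(nat \<Rightarrow> 'm) set \<Rightarrow> ('a \<Rightarrow> 'a \<Rightarrow> 'm) \<Rightarrow> (nat \<Rightarrow> 'a) \<Rightarrow> bool" where
  "Cauchy_sequence N d x \<longleftrightarrow>
    (\<forall>n m. strict_mono n \<and> strict_mono m \<and> (\<forall>k. n k < m k) \<longrightarrow>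
      (\<lambda>k. d (x (n k)) (x (m k))) \<in> N)"

definition complete_space :: "(nat \<Rightarrow> 'm) set \<Rightarrow> ('a \<Rightarrow> 'a \<Rightarrow> 'm) \<Rightarrow> bool" where
  "complete_space N d \<longleftrightarrow> (\<forall>x. Cauchy_sequence N d x \<longrightarrow> (\<exists>l. converges N d x l))"

locale FM_space = null_sequence_family N + distance_space d
  for N :: "(nat \<Rightarrow> 'm::partially_ordered_monoid) set" and d :: "'a \<Rightarrow> 'a \<Rightarrow> 'm" +
  assumes strong_Frechet_Wilson:
    "strict_mono n \<Longrightarrow> strict_mono m \<Longrightarrow> (\<And>k. n k < m k) \<Longrightarrow>
      (\<lambda>k. sum_list (map (\<lambda>s. d (x s) (x (Suc s))) [n k..<m k])) \<in> N \<Longrightarrow>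
      (\<lambda>k. d (x (n k)) (x (m k))) \<in> N"

definition upper_regular :: "(nat \<Rightarrow> 'm) set \<Rightarrow> ('a::order \<Rightarrow> 'a \<Rightarrow> 'm) \<Rightarrow> bool" where
  "upper_regular N d \<longleftrightarrow> (\<forall>x l. mono x \<and> converges N d x l \<longrightarrow> (\<forall>n. x n \<le> l))"

definition upper_Riesz :: "'a::order itself \<Rightarrow> bool" where
  "upper_Riesz _ \<longleftrightarrow>
    (\<forall>x y :: 'a. \<exists>s. x \<le> s \<and> y \<le> s \<and> (\<forall>u. x \<le> u \<and> y \<le> u \<longrightarrow> s \<le> u))"

definition comparable :: "'a::order \<Rightarrow> 'a \<Rightarrow> bool" where
  "comparable x y \<longleftrightarrow> x \<le> y \<or> y \<le> x"

text \<open>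
  Functions on the positive cone are represented by total functions, of which only the values
  on nonnegative arguments matter. The shift by \<^const>\<open>Suc\<close> makes the series start with the
  first iterate.
\<close>

definition comparison_maps ::
    "(nat \<Rightarrow> 'm::partially_ordered_monoid) set \<Rightarrow> ('m \<Rightarrow> 'm) set" where
  "comparison_maps N =
    {g. (\<forall>x. 0 \<le> x \<longrightarrow> 0 \<le> g x) \<and>
        (\<forall>x y. 0 \<le> x \<and> x \<le> y \<longrightarrow> g x \<le> g y) \<and>
        (\<forall>x \<in> N. (\<lambda>n. g (x n)) \<in> N) \<and>
        (\<forall>\<alpha>. 0 \<le> \<alpha> \<longrightarrow> Cauchy_series N (\<lambda>n. (g ^^ Suc n) \<alpha>))}"

end

(* The orbit of x0 is increasing and its consecutive distances are dominated by the iterates of the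
   comparison map, so the strong Frechet-Wilson property makes it Cauchy; upper regularity allows the
   contraction to be applied between the orbit and its limit z, so the orbit also tends to f z.
   Limits are unique by the Frechet-Wilson property applied to an interleaved sequence. The orbits of
   two comparable points approach each other, which gives both uniqueness claims; for the second one
   compares z and another fixed point with a common upper bound. *)

theory Submission
  imports Defs
begin

lemma sum_list_map_nonneg:
  fixes h :: "'b \<Rightarrow> 'm::partially_ordered_monoid"
  assumes "\<And>s. 0 \<le> h s"
  shows "0 \<le> sum_list (map h xs)"
proof (induction xs)
  case (Cons a xs)
  then show ?case using plus_mono[of 0 "h a" 0] assms by simp
qed simp

lemma sum_list_map_le:
  fixes h k :: "'b \<Rightarrow> 'm::partially_ordered_monoid"
  assumes "\<And>s. h s \<le> k s"
  shows "sum_list (map h xs) \<le> sum_list (map k xs)"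
  by (induction xs) (auto intro: plus_mono assms)

text \<open>With both index sequences equal to the identity, each block of the series is a single
  term.\<close>

lemma Cauchy_series_null:
  fixes N :: "(nat \<Rightarrow> 'm::partially_ordered_monoid) set"
  assumes "Cauchy_series N a"
  shows "a \<in> N"
proof -
  have "(\<lambda>k. sum_list (map a [id k..<Suc (id k)])) \<in> N"
    using assms[unfolded Cauchy_series_def, rule_format, of id id] by (simp add: strict_mono_def)
  then show ?thesis by simp
qed

context FM_space
begin

text \<open>Stands in for the triangle inequality. The sequences are interleaved as a 0, b 0, c 0, a
  1, b 1, c 1, ...; the block from 3k to 3k + 2 contains only the two steps known to be small and
  never the jump from c k to a (k + 1).\<close>

lemma null_dist_trans:
  assumes "(\<lambda>n. d (a n) (b n)) \<in> N" "(\<lambda>n. d (b n) (c n)) \<in> N"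
  shows "(\<lambda>n. d (a n) (c n)) \<in> N"
proof -
  define w where "w j = (if j mod 3 = 0 then a (j div 3)
    else if j mod 3 = 1 then b (j div 3) else c (j div 3))" for j :: nat
  have w0: "w (3 * k) = a k" for k by (simp add: w_def)
  have w1: "w (Suc (3 * k)) = b k" for k
  proof -
    have "Suc (3 * k) mod 3 = 1" "Suc (3 * k) div 3 = k" by presburger+
    then show ?thesis by (simp add: w_def)
  qed
  have w2: "w (Suc (Suc (3 * k))) = c k" for k
  proof -
    have "Suc (Suc (3 * k)) mod 3 = 2" "Suc (Suc (3 * k)) div 3 = k" by presburger+
    then show ?thesis by (simp add: w_def)
  qed
  have sums: "sum_list (map (\<lambda>s. d (w s) (w (Suc s))) [3 * k..<Suc (Suc (3 * k))])
      = d (a k) (b k) + d (b k) (c k)" for k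
    by (simp add: upt_rec w0 w1 w2)
  have "(\<lambda>k. d (w (3 * k)) (w (Suc (Suc (3 * k))))) \<in> N"
  proof (rule strong_Frechet_Wilson)
    show "(\<lambda>k. sum_list (map (\<lambda>s. d (w s) (w (Suc s))) [3 * k..<Suc (Suc (3 * k))])) \<in> N"
      using add[OF assms] unfolding sums .
  qed (auto simp: strict_mono_def)
  then show ?thesis by (simp add: w0 w2)
qed

lemma null_dist_sym: "(\<lambda>n. d (a n) (b n)) \<in> N \<Longrightarrow> (\<lambda>n. d (b n) (a n)) \<in> N"
  by (simp add: dist_sym)

text \<open>The sequence \<open>x\<close> is the middle term between two constant sequences, so the
  constant \<open>d l l'\<close> is null and hence zero.\<close>

lemma converges_unique:
  assumes "converges N d x l" "converges N d x l'"
  shows "l = l'"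
proof -
  have "(\<lambda>_. d l l') \<in> N"
    using null_dist_trans[of "\<lambda>_. l" x "\<lambda>_. l'"] null_dist_sym[of x "\<lambda>_. l"] assms
    unfolding converges_def by blast
  then show ?thesis using const_unique dist_nonneg dist_eq_zero_iff by blast
qed

lemma null_Suc_iff:
  assumes "\<And>n. 0 \<le> x n"
  shows "(\<lambda>n. x (Suc n)) \<in> N \<longleftrightarrow> x \<in> N"
proof -
  have "strict_mono Suc" by (simp add: strict_mono_def)
  moreover have "- range Suc = {0}" by (auto simp: image_iff) (metis not0_implies_Suc)
  ultimately show ?thesis
    using finite_addition[of x Suc] finite_removal[of x Suc] assms by (auto simp: comp_def)
qed

lemma converges_Suc_iff: "converges N d (\<lambda>n. x (Suc n)) l \<longleftrightarrow> converges N d x l"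
  unfolding converges_def by (rule null_Suc_iff) (rule dist_nonneg)

lemma Cauchy_sequence_if_dominated:
  assumes "Cauchy_series N a" and le: "\<And>s. d (x s) (x (Suc s)) \<le> a s"
  shows "Cauchy_sequence N d x"
  unfolding Cauchy_sequence_def
proof (intro allI impI, elim conjE)
  fix n m :: "nat \<Rightarrow> nat"
  assume n: "strict_mono n" and m: "strict_mono m" and nm: "\<forall>k. n k < m k"
  \<comment> \<open>Blocks of a Cauchy series include their last index, whereas the path from
    \<open>x (n k)\<close> to \<open>x (m k)\<close> ends with the step at \<open>m k - 1\<close>.
    Positivity of \<open>m k\<close> makes the truncated subtraction harmless.\<close>
  have pos: "0 < m k" for k using nm by (metis gr_implies_not0 gr0I)
  have "strict_mono (\<lambda>k. m k - 1)"
    using m pos by (simp add: strict_mono_def diff_less_mono Suc_leI)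
  moreover have "n k \<le> m k - 1" for k using nm by (metis Suc_pred' less_Suc_eq_le pos)
  ultimately have "(\<lambda>k. sum_list (map a [n k..<Suc (m k - 1)])) \<in> N"
    using assms(1)[unfolded Cauchy_series_def] n by blast
  then have "(\<lambda>k. sum_list (map a [n k..<m k])) \<in> N" using pos by simp
  then have "(\<lambda>k. sum_list (map (\<lambda>s. d (x s) (x (Suc s))) [n k..<m k])) \<in> N"
    by (rule dominated) (auto intro: sum_list_map_nonneg dist_nonneg sum_list_map_le le)
  then show "(\<lambda>k. d (x (n k)) (x (m k))) \<in> N"
    using strong_Frechet_Wilson[OF n m] nm by blast
qed

end

locale monotone_contraction = FM_space N d
  for N :: "(nat \<Rightarrow> 'm::partially_ordered_monoid) set" and d :: "'a::order \<Rightarrow> 'a \<Rightarrow> 'm" +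
  fixes g :: "'m \<Rightarrow> 'm" and f :: "'a \<Rightarrow> 'a"
  assumes comparison: "g \<in> comparison_maps N"
    and mono: "mono f"
    and contraction: "x \<le> y \<Longrightarrow> d (f x) (f y) \<le> g (d x y)"
begin

lemma comparison_mono: "0 \<le> a \<Longrightarrow> a \<le> b \<Longrightarrow> g a \<le> g b"
  and comparison_null: "x \<in> N \<Longrightarrow> (\<lambda>n. g (x n)) \<in> N"
  and comparison_series: "0 \<le> a \<Longrightarrow> Cauchy_series N (\<lambda>n. (g ^^ Suc n) a)"
  using comparison unfolding comparison_maps_def by blast+

lemma funpow_mono_le: "x \<le> y \<Longrightarrow> (f ^^ n) x \<le> (f ^^ n) y"
  by (induction n) (auto intro: monoD[OF mono])

text \<open>Monotonicity of \<open>f\<close> keeps the iterates comparable, so the contraction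
  applies at every stage; monotonicity of \<open>g\<close> propagates the bound.\<close>

lemma dist_funpow_le:
  assumes "x \<le> y"
  shows "d ((f ^^ n) x) ((f ^^ n) y) \<le> (g ^^ n) (d x y)"
proof (induction n)
  case (Suc n)
  then have "g (d ((f ^^ n) x) ((f ^^ n) y)) \<le> (g ^^ Suc n) (d x y)"
    using comparison_mono dist_nonneg by simp
  with contraction[OF funpow_mono_le[OF assms]] show ?case
    by (metis funpow.simps(2) o_apply order_trans)
qed simp

lemma null_dist_funpow_le:
  assumes "x \<le> y"
  shows "(\<lambda>n. d ((f ^^ n) x) ((f ^^ n) y)) \<in> N"
proof -
  \<comment> \<open>The series starts at the first iterate, so nullity is obtained for the shifted
    orbits and the initial distance is added back at the end.\<close>
  have "(\<lambda>n. (g ^^ Suc n) (d x y)) \<in> N"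
    by (intro Cauchy_series_null comparison_series dist_nonneg)
  then have "(\<lambda>n. d ((f ^^ Suc n) x) ((f ^^ Suc n) y)) \<in> N"
    by (rule dominated) (rule dist_nonneg, rule dist_funpow_le[OF assms])
  then show ?thesis
    using null_Suc_iff[of "\<lambda>n. d ((f ^^ n) x) ((f ^^ n) y)"] dist_nonneg by blast
qed

text \<open>The orbit of \<open>y\<close> is constant, and orbits of comparable points approach each
  other. Both uniqueness claims rest on this.\<close>

lemma orbit_converges_fixed_point:
  assumes "f y = y" "comparable y x"
  shows "converges N d (\<lambda>n. (f ^^ n) x) y"
proof -
  have "(f ^^ n) y = y" for n using assms(1) by (induction n) auto
  then show ?thesis
    using assms(2) null_dist_funpow_le[of x y] null_dist_sym[OF null_dist_funpow_le[of y x]]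
    unfolding converges_def comparable_def by auto
qed

lemma orbit_mono:
  assumes "x \<le> f x"
  shows "mono (\<lambda>n. (f ^^ n) x)"
  using funpow_mono_le[OF assms] by (intro mono_iff_le_Suc[THEN iffD2]) (simp add: funpow_swap1)

lemma orbit_convergent:
  assumes "complete_space N d" "x \<le> f x"
  shows "\<exists>z. converges N d (\<lambda>n. (f ^^ n) x) z"
proof -
  have "d ((f ^^ Suc s) x) ((f ^^ Suc (Suc s)) x) \<le> (g ^^ Suc s) (d x (f x))" for s
    using dist_funpow_le[OF assms(2), of "Suc s"] by (simp add: funpow_swap1)
  \<comment> \<open>Dropping the starting point aligns the step distances with the series of
    iterates; the limit is unaffected.\<close>
  then have "Cauchy_sequence N d (\<lambda>n. (f ^^ Suc n) x)"
    by (intro Cauchy_sequence_if_dominated[OF comparison_series]) (rule dist_nonneg)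
  then show ?thesis
    using assms(1) converges_Suc_iff[of "\<lambda>n. (f ^^ n) x"] unfolding complete_space_def by blast
qed

text \<open>The contraction covers only comparable pairs; \<open>le\<close> makes it available
  between the orbit and \<open>z\<close>, so the orbit tends to \<open>f z\<close> as well.\<close>

lemma orbit_limit_fixed:
  assumes conv: "converges N d (\<lambda>n. (f ^^ n) x) z" and le: "\<And>n. (f ^^ n) x \<le> z"
  shows "f z = z"
proof -
  have "(\<lambda>n. g (d ((f ^^ n) x) z)) \<in> N"
    using conv comparison_null unfolding converges_def by blast
  then have "(\<lambda>n. d ((f ^^ Suc n) x) (f z)) \<in> N"
    by (rule dominated) (auto intro: dist_nonneg contraction le)
  then have "converges N d (\<lambda>n. (f ^^ n) x) (f z)"
    using converges_Suc_iff[of "\<lambda>n. (f ^^ n) x"] unfolding converges_def by blast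
  then show ?thesis using conv converges_unique by blast
qed

end

theorem theorem3:
  fixes N :: "(nat \<Rightarrow> 'm::partially_ordered_monoid) set"
    and d :: "'a::order \<Rightarrow> 'a \<Rightarrow> 'm"
    and g :: "'m \<Rightarrow> 'm"
    and f :: "'a \<Rightarrow> 'a"
    and x0 :: 'a
  assumes "null_sequence_family N"
    and "FM_space N d"
    and "complete_space N d"
    and "upper_regular N d"
    and "g \<in> comparison_maps N"
    and "mono f"
    and "\<And>x y. x \<le> y \<Longrightarrow> d (f x) (f y) \<le> g (d x y)"
    and "x0 \<le> f x0"
  shows "\<exists>z. f z = z \<and>
    converges N d (\<lambda>n. (f ^^ n) x0) z \<and>
    comparable z x0 \<and>
    (\<forall>y. f y = y \<and> comparable y x0 \<longrightarrow> y = z) \<and>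
    (upper_Riesz TYPE('a) \<longrightarrow> (\<forall>y. f y = y \<longrightarrow> y = z))"
proof -
  interpret FM_space N d by fact
  interpret monotone_contraction N d g f by unfold_locales fact+
  obtain z where conv: "converges N d (\<lambda>n. (f ^^ n) x0) z"
    using orbit_convergent assms(3,8) by blast
  have le: "(f ^^ n) x0 \<le> z" for n
    using assms(4) orbit_mono[OF assms(8)] conv unfolding upper_regular_def by blast
  have fixed: "f z = z" using orbit_limit_fixed conv le by blast
  have "comparable z x0" using le[of 0] by (simp add: comparable_def)
  moreover have "y = z" if "f y = y" "comparable y x0" for y
    using converges_unique orbit_converges_fixed_point[OF that] conv by blast
  moreover have "y = z" if "upper_Riesz TYPE('a)" "f y = y" for y
  proof -
    \<comment> \<open>The orbit of the common upper bound \<open>s\<close> converges to both fixed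
      points, whether or not \<open>y\<close> is comparable with \<open>x0\<close>.\<close>
    obtain s where "y \<le> s" "z \<le> s" using \<open>upper_Riesz TYPE('a)\<close> unfolding upper_Riesz_def by blast
    then show ?thesis
      using converges_unique orbit_converges_fixed_point[of _ s] fixed \<open>f y = y\<close>
      unfolding comparable_def by blast
  qed
  ultimately show ?thesis using fixed conv by blast
qed

end
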